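(* Let $G$ be a connected graph of order at least $2$, let $H$ be a graph, and let $\mathcal{M}$ be the collection of all monophonic position sets of $G$. Then $$\mathrm{mp}(G\circ H)=\max_{M\in\mathcal{M}}\{\,n_M\cdot\omega(H)+r_M\cdot \mathrm{mp}(H)\,\}.$$
   Context: All graphs are finite, simple and undirected. A path in a graph is monophonic (induced) if there are no edges between non-consecutive vertices of the path. A set $M$ of vertices of a graph is a monophonic position set if no three distinct vertices of $M$ lie on a common monophonic path; $\mathrm{mp}(G)$ is the largest cardinality of a monophonic position set of $G$. $\omega(H)$ is the clique number. The lexicographic product $G\circ H$ has vertex set $V(G)\times V(H)$, with $(g_1,h_1)$ and $(g_2,h_2)$ adjacent iff $g_1\sim g_2$ in $G$, or ($g_1=g_2$ and $h_1\sim h_2$ in $H$). For a monophonic position set $M$ of the connected graph $G$, the components of the induced subgraph $G[M]$ (which are cliques) are denoted $A_1,\dots,A_k,B_1,\dots,B_r$, where $|A_i|\ge 2$ for each $i$ and $|B_j|=1$ for each $j$; then $n_M=\sum_{i=1}^k|A_i|$ and $r_M=r$ (the number of isolated vertices of $G[M]$), so $|M|=n_M+r_M$. *)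

theory Defs
  imports "Graph_Theory.Graph_Theory"
begin

text \<open>
  Finite simple undirected graphs are the symmetric digraphs of the locale
  \<^locale>\<open>pair_graph\<close> (or \<^locale>\<open>graph\<close>): finite, loop-free, without parallel arcs, every edge
  being represented by its two arcs. All notions below are meant for such graphs; in particular,
  testing one orientation of an edge suffices.
\<close>

text \<open>A path is given by its list of vertices; the one-vertex path is allowed.\<close>

definition monophonic_path :: "('a, 'b) pre_digraph \<Rightarrow> 'a list \<Rightarrow> bool" where
  "monophonic_path G p \<longleftrightarrow> vpath p G \<and>
     (\<forall>i j. Suc i < j \<and> j < length p \<longrightarrow> \<not> p ! i \<rightarrow>\<^bsub>G\<^esub> p ! j)"

definition monophonic_position_set :: "('a, 'b) pre_digraph \<Rightarrow> 'a set \<Rightarrow> bool" where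
  "monophonic_position_set G M \<longleftrightarrow> M \<subseteq> verts G \<and>
     (\<forall>x\<in>M. \<forall>y\<in>M. \<forall>z\<in>M. distinct [x, y, z] \<longrightarrow>
        \<not> (\<exists>p. monophonic_path G p \<and> {x, y, z} \<subseteq> set p))"

definition mp :: "('a, 'b) pre_digraph \<Rightarrow> nat" where
  "mp G = Max {card M |M. monophonic_position_set G M}"

definition clique :: "('a, 'b) pre_digraph \<Rightarrow> 'a set \<Rightarrow> bool" where
  "clique G K \<longleftrightarrow> K \<subseteq> verts G \<and> (\<forall>x\<in>K. \<forall>y\<in>K. x \<noteq> y \<longrightarrow> x \<rightarrow>\<^bsub>G\<^esub> y)"

definition clique_number :: "('a, 'b) pre_digraph \<Rightarrow> nat" where
  "clique_number G = Max {card K |K. clique G K}"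

definition lex_product ::
  "'a pair_pre_digraph \<Rightarrow> 'b pair_pre_digraph \<Rightarrow> ('a \<times> 'b) pair_pre_digraph" where
  "lex_product G H =
     \<lparr> pverts = pverts G \<times> pverts H,
       parcs = {((g1, h1), (g2, h2)) |g1 h1 g2 h2.
         g1 \<in> pverts G \<and> g2 \<in> pverts G \<and> h1 \<in> pverts H \<and> h2 \<in> pverts H \<and>
         ((g1, g2) \<in> parcs G \<or> g1 = g2 \<and> (h1, h2) \<in> parcs H)} \<rparr>"

text \<open>
  For a symmetric digraph the strongly connected components are the connected components of the
  undirected graph, so the following set contains the vertex sets of the components of the
  subgraph of \<open>G\<close> induced by \<open>M\<close>.
\<close>

definition induced_components :: "('a, 'b) pre_digraph \<Rightarrow> 'a set \<Rightarrow> 'a set set" where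
  "induced_components G M = pre_digraph.sccs_verts (G \<restriction> M)"

text \<open>The quantities $n_M$ and $r_M$.\<close>

definition n_part :: "('a, 'b) pre_digraph \<Rightarrow> 'a set \<Rightarrow> nat" where
  "n_part G M = (\<Sum>A\<in>{A \<in> induced_components G M. card A \<ge> 2}. card A)"

definition r_part :: "('a, 'b) pre_digraph \<Rightarrow> 'a set \<Rightarrow> nat" where
  "r_part G M = card {B \<in> induced_components G M. card B = 1}"

text \<open>
  Well-definedness: the product is again a finite simple graph, and the maxima above are taken
  over finite nonempty sets.
\<close>

lemma pair_graph_lex_product:
  assumes "pair_graph G" "pair_graph H"
  shows "pair_graph (lex_product G H)"
proof -
  interpret G: pair_graph G by fact
  interpret H: pair_graph H by fact
  have "parcs (lex_product G H) \<subseteq> (pverts G \<times> pverts H) \<times> (pverts G \<times> pverts H)"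
    by (auto simp: lex_product_def)
  moreover have "finite ((pverts G \<times> pverts H) \<times> (pverts G \<times> pverts H))"
    using G.pair_finite_verts H.pair_finite_verts by auto
  ultimately have "finite (parcs (lex_product G H))"
    by (rule finite_subset)
  then show ?thesis
    using G.pair_finite_verts H.pair_finite_verts
    by unfold_locales
      (auto simp: lex_product_def symmetric_def
         dest: G.arcs_symmetric H.arcs_symmetric G.no_loops' H.no_loops' intro!: symI)
qed

lemma finite_monophonic_position_sets:
  "finite (verts G) \<Longrightarrow> finite {M. monophonic_position_set G M}"
  by (rule finite_subset[of _ "Pow (verts G)"]) (auto simp: monophonic_position_set_def)

lemma monophonic_position_set_empty: "monophonic_position_set G {}"
  by (simp add: monophonic_position_set_def)

lemma finite_cliques: "finite (verts G) \<Longrightarrow> finite {K. clique G K}"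
  by (rule finite_subset[of _ "Pow (verts G)"]) (auto simp: clique_def)

lemma clique_empty: "clique G {}"
  by (simp add: clique_def)

end

theory Submission
  imports Defs
begin

text \<open>
  A monophonic path of \<open>G \<circ> H\<close> meets the fibres \<open>{g} \<times> H\<close> in one of only three ways
  (\<open>lex_product_monophonic_path_cases\<close>). Since a vertex outside a fibre is adjacent to all or to none
  of its vertices, and no vertex of a monophonic path has three neighbours on the path, a path that
  meets some fibre twice either stays in that fibre or has the form \<open>(g, a), x, (g, b)\<close> with \<open>a\<close>
  and \<open>b\<close> non-adjacent. A path that meets every fibre at most once projects to a monophonic path
  of \<open>G\<close>, and a path inside a fibre to a monophonic path of \<open>H\<close>.

  Consequently a set \<open>S\<close> of vertices of \<open>G \<circ> H\<close> is a monophonic position set iff its projection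
  \<open>M\<close> to \<open>G\<close> is one, every fibre of \<open>S\<close> is one in \<open>H\<close>, and the fibre over each vertex having a
  neighbour in \<open>M\<close> is a clique; the last condition is what the paths \<open>(g, a), x, (g, b)\<close> enforce.
  The two directions are \<open>monophonic_position_set_lex_product_Sigma\<close> and
  \<open>monophonic_position_set_lex_product_projections\<close>. If \<open>H\<close> is non-empty,
  a largest such \<open>S\<close> over a given \<open>M\<close> therefore consists of a maximum clique over each non-isolated
  vertex of \<open>G[M]\<close> and a maximum monophonic position set over each isolated one. As \<open>n_part\<close> and
  \<open>r_part\<close> count the vertices of these two kinds (\<open>part_sizes\<close>), its size is the expression that is
  maximised. For empty \<open>H\<close> both sides of the equation are \<open>0\<close>.
\<close>

section \<open>Monophonic paths\<close>

lemma set_vwalk_arcs_conv_nth: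
  "set (vwalk_arcs p) = {(p ! i, p ! Suc i) |i. Suc i < length p}"
proof (induction p rule: vwalk_arcs.induct)
  case (3 x y xs)
  have "{(f i, g i) |i. i < Suc n} = insert (f 0, g 0) {(f (Suc i), g (Suc i)) |i. i < n}"
    for f g :: "nat \<Rightarrow> 'a" and n
    by (auto simp: less_Suc_eq_0_disj)
  from this[of "(!) (x # y # xs)" "\<lambda>i. (x # y # xs) ! Suc i" "length xs"] 3
  show ?case by simp
qed auto

text \<open>
  Symmetry and the absence of loops turn the one-sided definition into a description of all
  adjacencies among the vertices of the path, so that both neighbours of a vertex are visible.
\<close>

lemma (in pair_graph) monophonic_path_iff:
  "monophonic_path G p \<longleftrightarrow> p \<noteq> [] \<and> distinct p \<and> set p \<subseteq> pverts G \<and>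
     (\<forall>i<length p. \<forall>j<length p. (p ! i, p ! j) \<in> parcs G \<longleftrightarrow> Suc i = j \<or> Suc j = i)"
    (is "?L \<longleftrightarrow> ?R")
proof
  assume L: ?L
  then have p: "p \<noteq> []" "distinct p" "set p \<subseteq> pverts G"
    by (auto simp: monophonic_path_def vpath_def vwalk_def)
  have step: "(p ! i, p ! Suc i) \<in> parcs G" if "Suc i < length p" for i
    using L that by (auto simp: monophonic_path_def vpath_def vwalk_def set_vwalk_arcs_conv_nth)
  have chord: "(p ! i, p ! j) \<notin> parcs G" if "Suc i < j" "j < length p" for i j
    using L that by (auto simp: monophonic_path_def)
  have "(p ! i, p ! j) \<in> parcs G \<longleftrightarrow> Suc i = j \<or> Suc j = i"
    if "i < length p" "j < length p" for i j
  proof -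
    consider "Suc i < j" | "Suc i = j" | "i = j" | "Suc j = i" | "Suc j < i" by linarith
    then show ?thesis
      using that step[of i] step[of j] chord[of i j] chord[of j i] no_loops'[of "p ! i" "p ! i"]
      by cases (auto simp: arcs_symmetric dest: arcs_symmetric)
  qed
  with p show ?R by blast
next
  assume ?R
  then show ?L
    by (auto simp: monophonic_path_def vpath_def vwalk_def set_vwalk_arcs_conv_nth)
qed

text \<open>
  Being monophonic depends only on the isomorphism type of the subgraph induced by the path. This
  transports paths between \<open>G\<close>, \<open>H\<close> and the product, in both directions.
\<close>

lemma monophonic_path_map:
  assumes "pair_graph G" "pair_graph G'" and p: "monophonic_path G p"
    and "inj_on f (set p)" and "f ` set p \<subseteq> pverts G'"
    and adj: "\<And>x y. x \<in> set p \<Longrightarrow> y \<in> set p \<Longrightarrow> (f x, f y) \<in> parcs G' \<longleftrightarrow> (x, y) \<in> parcs G"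
  shows "monophonic_path G' (map f p)"
proof -
  interpret G: pair_graph G by fact
  interpret G': pair_graph G' by fact
  show ?thesis
    using assms(4,5) p unfolding G.monophonic_path_iff G'.monophonic_path_iff
    by (auto simp: distinct_map adj)
qed

lemma (in pair_graph) monophonic_path_through_common_neighbour:
  assumes "(x, y) \<in> parcs G" "(y, z) \<in> parcs G" "(x, z) \<notin> parcs G" "x \<noteq> z"
  shows "monophonic_path G [x, y, z]"
  using assms no_loops'[of x y] no_loops'[of y z] no_loops'[of _ z]
  by (auto simp: monophonic_path_def vpath_def vwalk_def set_vwalk_arcs_conv_nth less_Suc_eq
      dest: wellformed')

section \<open>Position sets and cliques\<close>

lemma monophonic_position_setD:
  assumes "monophonic_position_set G M" "monophonic_path G p"
    and "x \<in> M" "y \<in> M" "z \<in> M" "distinct [x, y, z]" "{x, y, z} \<subseteq> set p"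
  shows False
  using assms unfolding monophonic_position_set_def by blast

text \<open>
  Three pairwise adjacent vertices of a monophonic path would have pairwise consecutive positions.
\<close>

lemma (in pair_graph) clique_imp_monophonic_position_set:
  assumes K: "clique G K"
  shows "monophonic_position_set G K"
  unfolding monophonic_position_set_def
proof (intro conjI ballI impI notI)
  fix x y z
  assume xyz: "x \<in> K" "y \<in> K" "z \<in> K" "distinct [x, y, z]"
    and "\<exists>p. monophonic_path G p \<and> {x, y, z} \<subseteq> set p"
  then obtain p i j k where p: "monophonic_path G p" and i: "i < length p" "x = p ! i"
    and j: "j < length p" "y = p ! j" and k: "k < length p" "z = p ! k"
    by (auto simp: in_set_conv_nth)
  have consecutive: "Suc a = b \<or> Suc b = a"
    if "a < length p" "b < length p" "p ! a \<in> K" "p ! b \<in> K" "p ! a \<noteq> p ! b" for a b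
    using K p that unfolding clique_def monophonic_path_iff with_proj_simps by blast
  have "Suc i = j \<or> Suc j = i" "Suc j = k \<or> Suc k = j" "Suc i = k \<or> Suc k = i"
    using consecutive[of i j] consecutive[of j k] consecutive[of i k] xyz i j k by simp_all
  then show False by arith
qed (use K in \<open>simp add: clique_def\<close>)

lemma (in pair_graph) card_le_mp: "monophonic_position_set G M \<Longrightarrow> card M \<le> mp G"
  unfolding mp_def using finite_monophonic_position_sets[of G]
  by (intro Max_ge) auto

lemma (in pair_graph) mp_attained: "\<exists>M. monophonic_position_set G M \<and> card M = mp G"
proof -
  have "mp G \<in> {card M |M. monophonic_position_set G M}"
    unfolding mp_def using finite_monophonic_position_sets[of G] monophonic_position_set_empty
    by (intro Max_in) auto
  then show ?thesis by auto
qed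

lemma (in pair_graph) card_le_clique_number: "clique G K \<Longrightarrow> card K \<le> clique_number G"
  unfolding clique_number_def using finite_cliques[of G]
  by (intro Max_ge) auto

lemma (in pair_graph) clique_number_attained: "\<exists>K. clique G K \<and> card K = clique_number G"
proof -
  have "clique_number G \<in> {card K |K. clique G K}"
    unfolding clique_number_def using finite_cliques[of G] clique_empty
    by (intro Max_in) auto
  then show ?thesis by auto
qed

section \<open>Isolated and non-isolated vertices of an induced subgraph\<close>

text \<open>
  The components are given through mutual reachability. An edge at \<open>g\<close> inside \<open>M\<close> can be
  traversed both ways, hence puts a second vertex into the component of \<open>g\<close>; conversely, a path to
  a second vertex begins with such an edge.
\<close>

lemma (in pair_graph) card_induced_component_eq_1_iff:
  assumes S: "S \<in> induced_components G M" and g: "g \<in> S"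
  shows "card S = 1 \<longleftrightarrow> (\<forall>g'\<in>M. (g, g') \<notin> parcs G)"
proof -
  let ?K = "with_proj G \<restriction> M"
  interpret K: wf_digraph ?K
    by (rule wellformed_induce_subgraph)
  have ends: "u \<rightarrow>\<^bsub>?K\<^esub> v \<longleftrightarrow> u \<in> M \<and> v \<in> M \<and> (u, v) \<in> parcs G" for u v
    by (auto simp: arcs_ends_def arc_to_ends_def image_iff)
  have S': "S \<in> K.sccs_verts"
    using S by (simp add: induced_components_def)
  have SM: "S \<subseteq> M"
    using K.sccs_verts_subsets[OF S'] by simp
  show ?thesis
  proof
    assume "card S = 1"
    with g have eq: "S = {g}" by (auto simp: card_1_singleton_iff)
    show "\<forall>g'\<in>M. (g, g') \<notin> parcs G"
    proof (intro ballI notI)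
      fix g' assume g': "g' \<in> M" "(g, g') \<in> parcs G"
      then have "g \<rightarrow>\<^bsub>?K\<^esub> g'" "g' \<rightarrow>\<^bsub>?K\<^esub> g"
        using SM g arcs_symmetric by (auto simp: ends)
      then have "g' \<in> S"
        using S' g K.reachable_adjI unfolding K.in_sccs_verts_conv_reachable by blast
      with eq g' show False using no_loops' by blast
    qed
  next
    assume isolated: "\<forall>g'\<in>M. (g, g') \<notin> parcs G"
    have "h = g" if "h \<in> S" for h
    proof -
      have "g \<rightarrow>\<^sup>*\<^bsub>?K\<^esub> h"
        using S' g that unfolding K.in_sccs_verts_conv_reachable by blast
      then show ?thesis
        by (cases rule: K.converse_reachable_cases) (use isolated in \<open>auto simp: ends\<close>)
    qed
    with g have "S = {g}" by blast
    then show "card S = 1" by simp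
  qed
qed

text \<open>
  The components partition \<open>M\<close>, so summing the sizes of the large ones counts the vertices
  that have a neighbour in \<open>M\<close>.
\<close>

lemma (in pair_graph) part_sizes:
  assumes fin: "finite M"
  shows "n_part G M = card {g \<in> M. \<exists>g'\<in>M. (g, g') \<in> parcs G}"
    and "r_part G M = card {g \<in> M. \<forall>g'\<in>M. (g, g') \<notin> parcs G}"
proof -
  let ?C = "induced_components G M"
  let ?K = "with_proj G \<restriction> M"
  interpret K: wf_digraph ?K
    by (rule wellformed_induce_subgraph)
  note iso = card_induced_component_eq_1_iff
  have sub: "S \<subseteq> M" "S \<noteq> {}" if "S \<in> ?C" for S
    using that K.sccs_verts_subsets[of S]
    by (auto simp: induced_components_def K.in_sccs_verts_conv_reachable)
  have card: "finite S" "card S \<noteq> 1 \<longleftrightarrow> 2 \<le> card S" if "S \<in> ?C" for S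
  proof -
    show "finite S" using sub[OF that] fin finite_subset by blast
    then have "card S \<noteq> 0" using sub[OF that] by auto
    then show "card S \<noteq> 1 \<longleftrightarrow> 2 \<le> card S" by arith
  qed
  have cover: "\<exists>S\<in>?C. g \<in> S" if "g \<in> M" for g
    using that K.scc_of_in_sccs_verts[of g] K.in_scc_of_self[of g]
    by (auto simp: induced_components_def)
  have disj: "S \<inter> T = {}" if "S \<in> ?C" "T \<in> ?C" "S \<noteq> T" for S T
    using that K.sccs_verts_disjoint by (auto simp: induced_components_def)
  have "n_part G M = card (\<Union> {A \<in> ?C. card A \<ge> 2})"
    unfolding n_part_def by (rule card_Union_disjoint[symmetric])
      (auto simp: pairwise_def disjnt_def card disj)
  also have "\<Union> {A \<in> ?C. card A \<ge> 2} = {g \<in> M. \<exists>g'\<in>M. (g, g') \<in> parcs G}" (is "?U = ?N")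
  proof (intro equalityI subsetI)
    fix g assume "g \<in> ?U"
    then obtain A where A: "A \<in> ?C" "card A \<ge> 2" "g \<in> A" by blast
    then show "g \<in> ?N" using iso[OF A(1,3)] card[OF A(1)] sub[OF A(1)] by auto
  next
    fix g assume g: "g \<in> ?N"
    then obtain A where A: "A \<in> ?C" "g \<in> A" using cover by blast
    then show "g \<in> ?U" using iso[OF A] card[OF A(1)] g by auto
  qed
  finally show "n_part G M = card ?N" .
  have "{B \<in> ?C. card B = 1} = (\<lambda>g. {g}) ` {g \<in> M. \<forall>g'\<in>M. (g, g') \<notin> parcs G}" (is "?O = _ ` ?I")
  proof (intro equalityI subsetI)
    fix B assume B: "B \<in> ?O"
    then obtain g where g: "B = {g}" by (auto simp: card_1_singleton_iff)
    with B show "B \<in> (\<lambda>g. {g}) ` ?I" using iso[of B M g] sub[of B] by auto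
  next
    fix B assume "B \<in> (\<lambda>g. {g}) ` ?I"
    then obtain g where g: "B = {g}" "g \<in> ?I" by blast
    then obtain A where A: "A \<in> ?C" "g \<in> A" using cover by blast
    then have c: "card A = 1" using iso[OF A] g by simp
    with A have "A = B" by (auto simp: card_1_singleton_iff g(1))
    with A c show "B \<in> ?O" by simp
  qed
  then show "r_part G M = card ?I"
    unfolding r_part_def by (simp add: card_image)
qed

text \<open>
  This is the form in which the sizes of the fibres over \<open>M\<close> are added up.
\<close>

lemma (in pair_graph) sum_over_parts:
  assumes fin: "finite M"
  shows "(\<Sum>g\<in>M. if \<exists>g'\<in>M. (g, g') \<in> parcs G then a else b)
    = n_part G M * a + r_part G M * b"
  using fin by (simp add: sum.If_cases part_sizes[OF fin] Int_def Compl_eq)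

section \<open>Monophonic paths in a lexicographic product\<close>

lemma lex_product_arc_iff:
  assumes "pair_graph G" "x \<in> pverts (lex_product G H)" "y \<in> pverts (lex_product G H)"
  shows "(x, y) \<in> parcs (lex_product G H) \<longleftrightarrow>
    (fst x, fst y) \<in> parcs G \<or> fst x = fst y \<and> (snd x, snd y) \<in> parcs H"
  using assms by (cases x; cases y) (auto simp: lex_product_def)

lemma lex_product_verts [simp]: "pverts (lex_product G H) = pverts G \<times> pverts H"
  by (simp add: lex_product_def)

lemma constant_on_initial_segment:
  assumes "\<And>m. Suc m < n \<Longrightarrow> P m \<longleftrightarrow> P (Suc m)" and "i < n" "l < n"
  shows "P i \<longleftrightarrow> P (l :: nat)"
proof -
  have "P k \<longleftrightarrow> P 0" if "k < n" for k
    using that by (induction k) (use assms(1) in auto)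
  then show ?thesis using assms by blast
qed

text \<open>
  A path that meets the fibre of \<open>g\<close> at \<open>i\<close> and \<open>j\<close> and also leaves it contains a vertex outside
  the fibre adjacent to one inside, hence to all inside. The path being monophonic, \<open>i\<close> and \<open>j\<close>
  are the two positions next to that vertex. A further vertex beyond either end would, in the fibre,
  be a third neighbour of the middle vertex and, outside the fibre, be adjacent to both ends, which are not
  both next to it.
\<close>

lemma lex_product_path_leaving_repeated_fibre:
  assumes G: "pair_graph G" and H: "pair_graph H"
    and p: "monophonic_path (lex_product G H) p"
    and ij: "i < j" "j < length p" and same: "fst (p ! i) = g" "fst (p ! j) = g"
    and l: "l < length p" "fst (p ! l) \<noteq> g"
  shows "i = 0 \<and> j = 2 \<and> length p = 3"
proof -
  interpret L: pair_graph "lex_product G H" by (rule pair_graph_lex_product) fact+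
  have in_verts: "p ! a \<in> pverts (lex_product G H)" if "a < length p" for a
    using p that unfolding L.monophonic_path_iff by auto
  have adj: "(fst (p ! a), fst (p ! b)) \<in> parcs G \<or>
      fst (p ! a) = fst (p ! b) \<and> (snd (p ! a), snd (p ! b)) \<in> parcs H \<longleftrightarrow> Suc a = b \<or> Suc b = a"
    if "a < length p" "b < length p" for a b
    using p that lex_product_arc_iff[OF G in_verts in_verts] unfolding L.monophonic_path_iff by blast
  \<comment> \<open>An outside vertex next to some vertex of the fibre is next to every vertex of the fibre.\<close>
  have near: "Suc m = a \<or> Suc a = m"
    if "m < length p" "m' < length p" "a < length p" "fst (p ! m) \<noteq> g"
      "fst (p ! m') = g" "fst (p ! a) = g" "Suc m = m' \<or> Suc m' = m" for m m' a
    using adj[of m m'] adj[of m a] that by auto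
  obtain m where m: "Suc m < length p" "(fst (p ! m) = g) \<noteq> (fst (p ! Suc m) = g)"
    using constant_on_initial_segment[of "length p" "\<lambda>k. fst (p ! k) = g" i l] same ij l by auto
  then obtain n n' where n: "n < length p" "n' < length p" "fst (p ! n) \<noteq> g" "fst (p ! n') = g"
    "Suc n = n' \<or> Suc n' = n"
    by (cases "fst (p ! m) = g") (metis Suc_lessD)+
  have nij: "n = Suc i" "j = Suc n"
    using near[OF n(1,2) _ n(3,4) _ n(5), of i] near[OF n(1,2) _ n(3,4) _ n(5), of j] ij same
    by auto
  have inside: "a \<in> {i, n, j}" if "a < length p" "Suc a = i \<or> Suc j = a" for a
  proof (cases "fst (p ! a) = g")
    case True
    then show ?thesis
      using near[OF n(1,2) that(1) n(3,4) _ n(5)] nij that by auto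
  next
    case False
    then show ?thesis
      using that(2) near[of a i j] near[of a j i] that ij same nij by auto
  qed
  have "i = 0"
    using inside[of "i - 1"] nij ij by (cases i) auto
  moreover have "length p = 3"
    using inside[of "Suc j"] nij ij \<open>i = 0\<close> by (cases "Suc j < length p") auto
  ultimately show ?thesis using nij by simp
qed

text \<open>
  The trichotomy on which both bounds rest: the projection to \<open>G\<close> repeats no vertex, or it
  is constant, or the path makes a detour through a neighbouring fibre
  to connect two non-adjacent vertices of one fibre.
\<close>

lemma lex_product_monophonic_path_cases:
  assumes G: "pair_graph G" and H: "pair_graph H"
    and p: "monophonic_path (lex_product G H) p"
  obtains (transversal) "monophonic_path G (map fst p)" "inj_on fst (set p)"
  | (fibre) g where "fst ` set p \<subseteq> {g}" "monophonic_path H (map snd p)"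
  | (detour) g a x b where "p = [(g, a), x, (g, b)]" "(g, fst x) \<in> parcs G" "a \<noteq> b" "(a, b) \<notin> parcs H"
proof -
  interpret G: pair_graph G by fact
  interpret H: pair_graph H by fact
  interpret L: pair_graph "lex_product G H" by (rule pair_graph_lex_product) fact+
  note L = L.pair_graph
  have vs: "set p \<subseteq> pverts (lex_product G H)" and dist: "distinct p"
    using p by (auto simp: L.monophonic_path_iff)
  have arc: "(x, y) \<in> parcs (lex_product G H) \<longleftrightarrow>
    (fst x, fst y) \<in> parcs G \<or> fst x = fst y \<and> (snd x, snd y) \<in> parcs H"
    if "x \<in> set p" "y \<in> set p" for x y
    using lex_product_arc_iff[OF G] vs that by blast
  show thesis
  proof (cases "inj_on fst (set p)")
    case True
    have "monophonic_path G (map fst p)"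
      by (rule monophonic_path_map[OF L G p True])
        (use vs True in \<open>auto simp: arc inj_on_eq_iff dest: H.no_loops'\<close>)
    then show thesis using True by (rule transversal)
  next
    case False
    then obtain u v where "u \<in> set p" "v \<in> set p" "u \<noteq> v" "fst u = fst v"
      unfolding inj_on_def by blast
    then obtain i' j' where ij': "i' < length p" "j' < length p" "i' \<noteq> j'"
      "fst (p ! i') = fst (p ! j')"
      by (metis in_set_conv_nth)
    obtain i j where ij: "i < j" "j < length p" "fst (p ! i) = fst (p ! j)"
      using ij' by (cases i' j' rule: linorder_cases) auto
    let ?g = "fst (p ! j)"
    show thesis
    proof (cases "fst ` set p \<subseteq> {?g}")
      case True
      then have g: "fst x = ?g" if "x \<in> set p" for x using that by blast
      have inj: "inj_on snd (set p)"
        by (rule inj_onI) (metis g prod_eqI)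
      have "monophonic_path H (map snd p)"
      proof (rule monophonic_path_map[OF L H p inj])
        show "(snd x, snd y) \<in> parcs H \<longleftrightarrow> (x, y) \<in> parcs (lex_product G H)"
          if "x \<in> set p" "y \<in> set p" for x y
          using arc[OF that] g[OF that(1)] g[OF that(2)] G.no_loops'[of "fst x" "fst y"] by auto
      qed (use vs in auto)
      with True show thesis by (rule fibre)
    next
      case False
      then obtain w where "w \<in> set p" "fst w \<noteq> ?g" by blast
      then obtain l where l: "l < length p" "fst (p ! l) \<noteq> ?g" by (metis in_set_conv_nth)
      have *: "i = 0 \<and> j = 2 \<and> length p = 3"
        by (rule lex_product_path_leaving_repeated_fibre[OF G H p ij(1,2,3) refl l])
      then obtain u x v where puv: "p = [u, x, v]"
        by (auto simp: numeral_3_eq_3 length_Suc_conv)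
      have fx: "fst u = fst v" "fst x \<noteq> fst v"
        using ij l puv * by (auto simp: less_Suc_eq numeral_3_eq_3 nth_Cons')
      have idx: "(p ! a, p ! b) \<in> parcs (lex_product G H) \<longleftrightarrow> Suc a = b \<or> Suc b = a"
        if "a < length p" "b < length p" for a b
        using p that by (auto simp: L.monophonic_path_iff)
      have "(u, x) \<in> parcs (lex_product G H)" "(u, v) \<notin> parcs (lex_product G H)"
        using idx[of 0 1] idx[of 0 2] puv by auto
      then have "(fst v, fst x) \<in> parcs G" "(snd u, snd v) \<notin> parcs H"
        using arc[of u x] arc[of u v] puv fx by auto
      moreover have "snd u \<noteq> snd v" using dist puv fx by (auto simp: prod_eq_iff)
      ultimately show thesis
        using puv fx by (intro detour[of "fst v" "snd u" x "snd v"]) (auto simp: prod_eq_iff)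
    qed
  qed
qed

section \<open>Position sets of a lexicographic product\<close>

text \<open>
  Each of the three shapes of a path is excluded by one hypothesis: transversal paths by \<open>M\<close>, paths
  in a fibre by \<open>F g\<close>. A detour has only three vertices; if all of them lie in the set, then \<open>g\<close> has
  a neighbour in \<open>M\<close>, and the two non-adjacent end vertices contradict that \<open>F g\<close> is a clique.
\<close>

lemma monophonic_position_set_lex_product_Sigma:
  assumes G: "pair_graph G" and H: "pair_graph H"
    and M: "monophonic_position_set G M"
    and F: "\<And>g. g \<in> M \<Longrightarrow> monophonic_position_set H (F g)"
    and cl: "\<And>g g'. g \<in> M \<Longrightarrow> g' \<in> M \<Longrightarrow> (g, g') \<in> parcs G \<Longrightarrow> clique H (F g)"
  shows "monophonic_position_set (lex_product G H) (Sigma M F)"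
  unfolding monophonic_position_set_def
proof (intro conjI ballI impI notI)
  show "Sigma M F \<subseteq> verts (lex_product G H)"
    using M F unfolding monophonic_position_set_def by fastforce
next
  fix x y z
  assume S: "x \<in> Sigma M F" "y \<in> Sigma M F" "z \<in> Sigma M F" and d: "distinct [x, y, z]"
    and "\<exists>p. monophonic_path (lex_product G H) p \<and> {x, y, z} \<subseteq> set p"
  then obtain p where p: "monophonic_path (lex_product G H) p" and sub: "{x, y, z} \<subseteq> set p"
    by blast
  from G H p show False
  proof (cases rule: lex_product_monophonic_path_cases)
    case transversal
    show False
      by (rule monophonic_position_setD[OF M transversal(1), of "fst x" "fst y" "fst z"])
        (use S d sub transversal(2) in \<open>auto simp: inj_on_eq_iff image_iff\<close>)
  next
    case (fibre g)
    have g: "fst x = g" "fst y = g" "fst z = g" using fibre(1) sub by auto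
    then have "g \<in> M" using S by auto
    then show False
      by (rule monophonic_position_setD[OF F fibre(2), of g "snd x" "snd y" "snd z"])
        (use S d sub g in \<open>auto simp: prod_eq_iff image_iff\<close>)
  next
    case (detour g a w b)
    have "card {x, y, z} = 3" "card (set p) \<le> 3"
      using d detour(1) card_length[of p] by auto
    then have "set p = {x, y, z}"
      using sub by (metis card_seteq finite_set)
    then have "set p \<subseteq> Sigma M F" using S by (metis empty_subsetI insert_subset)
    then have "clique H (F g)" "a \<in> F g" "b \<in> F g"
      using cl[of g "fst w"] detour by (auto)
    then show False using detour unfolding clique_def by auto
  qed
qed

text \<open>
  In each case an offending path lifts to the product: a path of \<open>G\<close> along any choice of one vertex
  per fibre, a path of \<open>H\<close> into the fibre, and a pair of non-adjacent vertices in the fibre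
  of \<open>g\<close> to a detour through a vertex of \<open>S\<close> in the fibre of \<open>g'\<close>.
\<close>

lemma monophonic_position_set_lex_product_projections:
  assumes G: "pair_graph G" and H: "pair_graph H"
    and S: "monophonic_position_set (lex_product G H) S"
  shows "monophonic_position_set G (fst ` S)"
    and "monophonic_position_set H (S `` {g})"
    and "\<lbrakk>(g, g') \<in> parcs G; g' \<in> fst ` S\<rbrakk> \<Longrightarrow> clique H (S `` {g})"
proof -
  interpret G: pair_graph G by fact
  interpret H: pair_graph H by fact
  interpret L: pair_graph "lex_product G H" by (rule pair_graph_lex_product) fact+
  note L = L.pair_graph
  have sub: "S \<subseteq> pverts G \<times> pverts H"
    using S by (simp add: monophonic_position_set_def)
  show "monophonic_position_set G (fst ` S)"
    unfolding monophonic_position_set_def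
  proof (intro conjI ballI impI notI)
    fix x y z
    assume xyz: "x \<in> fst ` S" "y \<in> fst ` S" "z \<in> fst ` S" and d: "distinct [x, y, z]"
      and "\<exists>p. monophonic_path G p \<and> {x, y, z} \<subseteq> set p"
    then obtain p where p: "monophonic_path G p" "{x, y, z} \<subseteq> set p" by blast
    obtain a b c where abc: "(x, a) \<in> S" "(y, b) \<in> S" "(z, c) \<in> S" using xyz by auto
    \<comment> \<open>The lift has to pass through the three given vertices; elsewhere \<open>c\<close> is an arbitrary choice.\<close>
    define s where "s = (\<lambda>g. (g, if g = x then a else if g = y then b else c))"
    have vs: "s ` set p \<subseteq> pverts (lex_product G H)"
      using p(1) abc sub by (auto simp: s_def G.monophonic_path_iff)
    have "monophonic_path (lex_product G H) (map s p)"
    proof (rule monophonic_path_map[OF G L p(1) _ vs])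
      show "inj_on s (set p)" by (auto simp: s_def inj_on_def)
      show "(s u, s v) \<in> parcs (lex_product G H) \<longleftrightarrow> (u, v) \<in> parcs G"
        if "u \<in> set p" "v \<in> set p" for u v
      proof -
        have "s u \<in> pverts (lex_product G H)" "s v \<in> pverts (lex_product G H)"
          using vs that by blast+
        from lex_product_arc_iff[OF G this] show ?thesis
          by (auto simp: s_def dest: H.no_loops')
      qed
    qed
    then show False
      by (rule monophonic_position_setD[OF S, of _ "(x, a)" "(y, b)" "(z, c)"])
        (use p(2) d abc in \<open>auto simp: s_def image_iff\<close>)
  qed (use sub in auto)
  show "monophonic_position_set H (S `` {g})"
    unfolding monophonic_position_set_def
  proof (intro conjI ballI impI notI)
    fix x y z
    assume xyz: "x \<in> S `` {g}" "y \<in> S `` {g}" "z \<in> S `` {g}" and d: "distinct [x, y, z]"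
      and "\<exists>p. monophonic_path H p \<and> {x, y, z} \<subseteq> set p"
    then obtain p where p: "monophonic_path H p" "{x, y, z} \<subseteq> set p" by blast
    have vs: "Pair g ` set p \<subseteq> pverts (lex_product G H)"
      using p(1) xyz sub by (auto simp: H.monophonic_path_iff)
    have "monophonic_path (lex_product G H) (map (Pair g) p)"
    proof (rule monophonic_path_map[OF H L p(1) _ vs])
      show "((g, u), (g, v)) \<in> parcs (lex_product G H) \<longleftrightarrow> (u, v) \<in> parcs H"
        if "u \<in> set p" "v \<in> set p" for u v
        using lex_product_arc_iff[OF G, of "(g, u)" H "(g, v)"] vs that by (auto dest: G.no_loops')
    qed (auto simp: inj_on_def)
    then show False
      by (rule monophonic_position_setD[OF S, of _ "(g, x)" "(g, y)" "(g, z)"])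
        (use p(2) d xyz in auto)
  qed (use sub in auto)
  show "clique H (S `` {g})" if g': "(g, g') \<in> parcs G" "g' \<in> fst ` S"
    unfolding clique_def
  proof (intro conjI ballI impI)
    fix a b assume ab: "a \<in> S `` {g}" "b \<in> S `` {g}" "a \<noteq> b"
    obtain c where c: "(g', c) \<in> S" using g' by auto
    have "g \<noteq> g'" "(g', g) \<in> parcs G"
      using g' G.no_loops' G.arcs_symmetric by blast+
    have vs: "(g, a) \<in> pverts (lex_product G H)" "(g, b) \<in> pverts (lex_product G H)"
      "(g', c) \<in> pverts (lex_product G H)" using ab c sub by auto
    show "a \<rightarrow>\<^bsub>with_proj H\<^esub> b"
    proof (rule ccontr)
      assume "\<not> a \<rightarrow>\<^bsub>with_proj H\<^esub> b"
      then have "monophonic_path (lex_product G H) [(g, a), (g', c), (g, b)]"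
        using g' ab vs \<open>(g', g) \<in> parcs G\<close>
        by (intro L.monophonic_path_through_common_neighbour)
          (auto simp: lex_product_arc_iff[OF G] dest: G.no_loops')
      then show False
        by (rule monophonic_position_setD[OF S, of _ "(g, a)" "(g', c)" "(g, b)"])
          (use ab c \<open>g \<noteq> g'\<close> in auto)
    qed
  qed (use sub in auto)
qed

theorem theorem4p4:
  fixes G :: "'a pair_pre_digraph" and H :: "'b pair_pre_digraph"
  assumes "pair_graph G" and "connected (with_proj G)" and "card (pverts G) \<ge> 2"
    and "pair_graph H"
  shows "mp (with_proj (lex_product G H)) =
    Max {n_part (with_proj G) M * clique_number (with_proj H) +
         r_part (with_proj G) M * mp (with_proj H) |M.
         monophonic_position_set (with_proj G) M}"
proof -
  note G = \<open>pair_graph G\<close> and H = \<open>pair_graph H\<close>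
  interpret G: pair_graph G by fact
  interpret H: pair_graph H by fact
  interpret L: pair_graph "lex_product G H" by (rule pair_graph_lex_product) fact+
  let ?w = "\<lambda>M. n_part G M * clique_number H + r_part G M * mp H"
  let ?f = "\<lambda>M g. if \<exists>g'\<in>M. (g, g') \<in> parcs G then clique_number H else mp H"
  have M_fin: "finite M" "?w M = (\<Sum>g\<in>M. ?f M g)" if "monophonic_position_set G M" for M
    using that finite_subset[OF _ G.pair_finite_verts] G.sum_over_parts[of M]
    by (auto simp: monophonic_position_set_def)
  have H_fin: "finite F" if "monophonic_position_set H F" for F
    using that finite_subset[OF _ H.pair_finite_verts] by (auto simp: monophonic_position_set_def)
  obtain K P where K: "clique H K" "card K = clique_number H"
    and P: "monophonic_position_set H P" "card P = mp H"
    using H.clique_number_attained H.mp_attained by blast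
  have lower: "?w M \<le> mp (lex_product G H)" if M: "monophonic_position_set G M" for M
  proof -
    define F where "F g = (if \<exists>g'\<in>M. (g, g') \<in> parcs G then K else P)" for g
    have F: "monophonic_position_set H (F g)" for g
      using K(1) P(1) H.clique_imp_monophonic_position_set by (simp add: F_def)
    have "?w M = (\<Sum>g\<in>M. card (F g))"
      unfolding M_fin(2)[OF M] by (rule sum.cong) (auto simp: F_def K P)
    also have "\<dots> = card (Sigma M F)"
      using M_fin(1)[OF M] H_fin[OF F] by simp
    also have "\<dots> \<le> mp (lex_product G H)"
      by (intro L.card_le_mp monophonic_position_set_lex_product_Sigma G H M F)
        (auto simp: F_def K)
    finally show ?thesis .
  qed
  obtain S where S: "monophonic_position_set (lex_product G H) S" "card S = mp (lex_product G H)"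
    using L.mp_attained by blast
  note proj = monophonic_position_set_lex_product_projections[OF G H S(1)]
  have upper: "mp (lex_product G H) \<le> ?w (fst ` S)"
  proof -
    have "S = Sigma (fst ` S) (\<lambda>g. S `` {g})" by force
    then have "card S = card (Sigma (fst ` S) (\<lambda>g. S `` {g}))" by simp
    also have "\<dots> = (\<Sum>g\<in>fst ` S. card (S `` {g}))"
      using M_fin(1)[OF proj(1)] H_fin[OF proj(2)] by (intro card_SigmaI) auto
    also have "\<dots> \<le> (\<Sum>g\<in>fst ` S. ?f (fst ` S) g)"
      using H.card_le_mp[OF proj(2)] H.card_le_clique_number[OF proj(3)]
      by (intro sum_mono) auto
    also have "\<dots> = ?w (fst ` S)" using M_fin(2)[OF proj(1)] by simp
    finally show ?thesis using S(2) by simp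
  qed
  show ?thesis
  proof (rule Max_eqI[symmetric])
    show "finite {?w M |M. monophonic_position_set G M}"
      using finite_monophonic_position_sets[of G] by simp
    show "y \<le> mp (lex_product G H)" if "y \<in> {?w M |M. monophonic_position_set G M}" for y
      using that lower by blast
    show "mp (lex_product G H) \<in> {?w M |M. monophonic_position_set G M}"
      using order.antisym[OF upper lower[OF proj(1)]] proj(1) by blast
  qed
qed

end
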